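(* Let $I\subset(0,\infty)$ be an interval, let $f:I\to\mathbb{R}$ be a differentiable function on the interior $I^\circ$, let $a,b\in I$ with $a<b$, and let $f'\in L[a,b]$. Let $\alpha>0$, $s\in(0,1]$ and $q\ge1$. If $|f'|^q$ is harmonically $s$-convex on $[a,b]$, then for all $x\in[a,b]$, $$|S_f(g;\alpha;x,a,b)|\le\left(\frac{1}{\alpha+1}\right)^{1-\frac1q}\Bigg\{\lambda_5^{1-\frac1q}(a,x,\alpha)\frac{(x-a)^{\alpha+1}}{(ax)^{\alpha-1}}\Big(\lambda_1(a,x,s,1,\alpha)|f'(x)|^q+\lambda_2(a,x,s,1,\alpha)|f'(a)|^q\Big)^{\frac1q}+\lambda_6^{1-\frac1q}(b,x,\alpha)\frac{(b-x)^{\alpha+1}}{(bx)^{\alpha-1}}\Big(\lambda_3(b,x,s,1,\alpha)|f'(x)|^q+\lambda_4(b,x,s,1,\alpha)|f'(b)|^q\Big)^{\frac1q}\Bigg\},$$ where $$\lambda_5(a,x,\alpha)=\frac{1}{x^2}\,{}_2F_1\!\left(2,\alpha+1;\alpha+2;1-\tfrac ax\right),\qquad \lambda_6(b,x,\alpha)=\frac{1}{b^2}\,{}_2F_1\!\left(2,1;\alpha+2;1-\tfrac xb\right).$$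
   Context: A function $h:K\to\mathbb{R}$ on an interval $K\subset(0,\infty)$ is harmonically $s$-convex ($s\in(0,1]$ fixed) if $h\left(\frac{uv}{tu+(1-t)v}\right)\le t^s h(v)+(1-t)^s h(u)$ for all $u,v\in K$, $t\in[0,1]$. With $g(u)=1/u$, $$S_f(g;\alpha;x,a,b)=\left[\left(\frac{x-a}{ax}\right)^{\alpha}+\left(\frac{b-x}{bx}\right)^{\alpha}\right]f(x)-\Gamma(\alpha+1)\left\{J_{1/x-}^{\alpha}(f\circ g)(1/b)+J_{1/x+}^{\alpha}(f\circ g)(1/a)\right\},$$ where $\Gamma$ is the Gamma function and the Riemann–Liouville fractional integrals are $J_{c+}^{\alpha}h(y)=\frac{1}{\Gamma(\alpha)}\int_c^y(y-t)^{\alpha-1}h(t)\,dt$ ($y>c$) and $J_{d-}^{\alpha}h(y)=\frac{1}{\Gamma(\alpha)}\int_y^d(t-y)^{\alpha-1}h(t)\,dt$ ($y<d$); an integral over a degenerate interval (when $x=a$ or $x=b$) is $0$. Beta function: $\beta(u,v)=\int_0^1t^{u-1}(1-t)^{v-1}dt$ for $u,v>0$. Hypergeometric function: ${}_2F_1(A,B;C;z)=\frac{1}{\beta(B,C-B)}\int_0^1t^{B-1}(1-t)^{C-B-1}(1-zt)^{-A}dt$ for $C>B>0$, $|z|<1$. Define $$\lambda_1(a,x,s,\vartheta,\rho)=\frac{\beta(\rho+s+1,1)}{x^{2\vartheta}}\,{}_2F_1\!\left(2\vartheta,\rho+s+1;\rho+s+2;1-\tfrac ax\right),$$ $$\lambda_2(a,x,s,\vartheta,\rho)=\frac{\beta(\rho+1,s+1)}{x^{2\vartheta}}\,{}_2F_1\!\left(2\vartheta,\rho+1;\rho+s+2;1-\tfrac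 ax\right),$$ $$\lambda_3(b,x,s,\vartheta,\rho)=\frac{\beta(1,\rho+s+1)}{b^{2\vartheta}}\,{}_2F_1\!\left(2\vartheta,1;\rho+s+2;1-\tfrac xb\right),$$ $$\lambda_4(b,x,s,\vartheta,\rho)=\frac{\beta(s+1,\rho+1)}{b^{2\vartheta}}\,{}_2F_1\!\left(2\vartheta,s+1;\rho+s+2;1-\tfrac xb\right).$$ $\lambda_i^{r}(\cdot)$ denotes the $r$-th power of $\lambda_i(\cdot)$. $L[a,b]$ denotes the integrable functions on $[a,b]$. The derivative $f'$ is regarded as a function on $[a,b]$; if $a$ or $b$ is an endpoint of $I$, $f'$ there is the one-sided derivative. *)

theory Defs
  imports "HOL-Analysis.Analysis"
begin

definition harmonically_s_convex_on :: "real \<Rightarrow> real set \<Rightarrow> (real \<Rightarrow> real) \<Rightarrow> bool" where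
  "harmonically_s_convex_on s K h \<longleftrightarrow>
     is_interval K \<and> K \<subseteq> {0<..} \<and>
     (\<forall>u\<in>K. \<forall>v\<in>K. \<forall>t\<in>{0..1}.
        h (u * v / (t * u + (1 - t) * v)) \<le> t powr s * h v + (1 - t) powr s * h u)"

text \<open>Riemann--Liouville integrals of order \<open>\<alpha>\<close>: \<open>RL_right c \<alpha> h y\<close> is the integral based at \<open>c+\<close>,
  evaluated at \<open>y > c\<close>; \<open>RL_left d \<alpha> h y\<close> is the one based at \<open>d-\<close>, evaluated at \<open>y < d\<close>.
  For \<open>y = c\<close> or \<open>y = d\<close> the domain of integration is a point and the value is 0.\<close>

definition RL_right :: "real \<Rightarrow> real \<Rightarrow> (real \<Rightarrow> real) \<Rightarrow> real \<Rightarrow> real" where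
  "RL_right c \<alpha> h y = 1 / Gamma \<alpha> * integral {c..y} (\<lambda>t. (y - t) powr (\<alpha> - 1) * h t)"

definition RL_left :: "real \<Rightarrow> real \<Rightarrow> (real \<Rightarrow> real) \<Rightarrow> real \<Rightarrow> real" where
  "RL_left d \<alpha> h y = 1 / Gamma \<alpha> * integral {y..d} (\<lambda>t. (t - y) powr (\<alpha> - 1) * h t)"

definition S_func ::
  "(real \<Rightarrow> real) \<Rightarrow> (real \<Rightarrow> real) \<Rightarrow> real \<Rightarrow> real \<Rightarrow> real \<Rightarrow> real \<Rightarrow> real" where
  "S_func f g \<alpha> x a b =
     (((x - a) / (a * x)) powr \<alpha> + ((b - x) / (b * x)) powr \<alpha>) * f x
     - Gamma (\<alpha> + 1) *
       (RL_left (1 / x) \<alpha> (f \<circ> g) (1 / b) + RL_right (1 / x) \<alpha> (f \<circ> g) (1 / a))"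

text \<open>Euler's integral representation, for \<open>C > B > 0\<close> and \<open>\<bar>z\<bar> < 1\<close>. The library's \<open>Beta\<close> is
  defined through \<open>Gamma\<close>; it is the usual Beta integral by \<open>has_integral_Beta_real\<close>.\<close>

definition hyp2F1 :: "real \<Rightarrow> real \<Rightarrow> real \<Rightarrow> real \<Rightarrow> real" where
  "hyp2F1 A B C z = 1 / Beta B (C - B) *
     integral {0..1} (\<lambda>t. t powr (B - 1) * (1 - t) powr (C - B - 1) * (1 - z * t) powr (- A))"

definition lambda1 :: "real \<Rightarrow> real \<Rightarrow> real \<Rightarrow> real \<Rightarrow> real \<Rightarrow> real" where
  "lambda1 a x s \<theta> \<rho> = Beta (\<rho> + s + 1) 1 / x powr (2 * \<theta>) *
     hyp2F1 (2 * \<theta>) (\<rho> + s + 1) (\<rho> + s + 2) (1 - a / x)"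

definition lambda2 :: "real \<Rightarrow> real \<Rightarrow> real \<Rightarrow> real \<Rightarrow> real \<Rightarrow> real" where
  "lambda2 a x s \<theta> \<rho> = Beta (\<rho> + 1) (s + 1) / x powr (2 * \<theta>) *
     hyp2F1 (2 * \<theta>) (\<rho> + 1) (\<rho> + s + 2) (1 - a / x)"

definition lambda3 :: "real \<Rightarrow> real \<Rightarrow> real \<Rightarrow> real \<Rightarrow> real \<Rightarrow> real" where
  "lambda3 b x s \<theta> \<rho> = Beta 1 (\<rho> + s + 1) / b powr (2 * \<theta>) *
     hyp2F1 (2 * \<theta>) 1 (\<rho> + s + 2) (1 - x / b)"

definition lambda4 :: "real \<Rightarrow> real \<Rightarrow> real \<Rightarrow> real \<Rightarrow> real \<Rightarrow> real" where
  "lambda4 b x s \<theta> \<rho> = Beta (s + 1) (\<rho> + 1) / b powr (2 * \<theta>) *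
     hyp2F1 (2 * \<theta>) (s + 1) (\<rho> + s + 2) (1 - x / b)"

definition lambda5 :: "real \<Rightarrow> real \<Rightarrow> real \<Rightarrow> real" where
  "lambda5 a x \<alpha> = 1 / x\<^sup>2 * hyp2F1 2 (\<alpha> + 1) (\<alpha> + 2) (1 - a / x)"

definition lambda6 :: "real \<Rightarrow> real \<Rightarrow> real \<Rightarrow> real" where
  "lambda6 b x \<alpha> = 1 / b\<^sup>2 * hyp2F1 2 1 (\<alpha> + 2) (1 - x / b)"

end

theory Submission imports Defs begin

text \<open>For an endpoint \<open>c\<close> of the interval put \<open>\<phi>(t) = f (c x / (t c + (1 - t) x))\<close>, so that
  \<open>\<phi>(1) = f x\<close>. After an affine substitution in the fractional integrals, \<open>S_func\<close> is a sum of two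
  terms \<open>\<bar>1/c - 1/x\<bar>\<^sup>\<alpha> (\<phi>(1) - \<alpha> \<integral> t\<^sup>\<alpha>\<^sup>-\<^sup>1 \<phi>(t) dt)\<close>, and integration by parts turns the bracket
  into \<open>\<integral> t\<^sup>\<alpha> \<phi>'(t) dt\<close>. The weight \<open>t\<^sup>\<alpha> / (t c + (1 - t) x)\<^sup>2\<close> appearing in \<open>t\<^sup>\<alpha> \<phi>'(t)\<close> is then used in
  the power mean inequality, harmonic \<open>s\<close>-convexity bounds \<open>\<bar>f'\<bar>\<^sup>q\<close> pointwise along the segment, and
  the remaining integrals are Euler integrals of hypergeometric functions. Convexity also bounds
  \<open>f'\<close>, which makes the derivative \<open>\<phi>'\<close> absolutely integrable.\<close>

section \<open>Weighted power mean inequality\<close>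

text \<open>Young's inequality with weights \<open>1 - 1/q\<close> and \<open>1/q\<close> applied to
  \<open>m\<close> and \<open>m powr (1 - q) * g powr q\<close>, whose weighted geometric mean is
  exactly \<open>g\<close>. The right side is affine in \<open>g powr q\<close>, so it can be
  integrated, and \<open>m\<close> stays free for optimization.\<close>

lemma powr_young:
  fixes g m q :: real
  assumes "g \<ge> 0" "m > 0" "q \<ge> 1"
  shows "g \<le> (1 - 1/q) * m + (1/q) * (m powr (1 - q) * g powr q)"
proof (cases "g = 0")
  case True
  with assms show ?thesis by simp
next
  case False
  with assms have g: "g > 0" by simp
  have "m powr (1 - 1/q) * (m powr (1 - q) * g powr q) powr (1/q)
      \<le> (1 - 1/q) * m + (1/q) * (m powr (1 - q) * g powr q)"
    by (rule Youngs_inequality_0) (use assms g in \<open>auto simp: field_simps\<close>)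
  moreover have "(m powr (1 - q) * g powr q) powr (1/q) = m powr ((1 - q) * (1/q)) * g"
    using assms g by (simp add: powr_mult powr_powr)
  moreover have "m powr (1 - 1/q) * m powr ((1 - q) * (1/q)) = 1"
    using assms by (simp add: powr_add[symmetric] field_simps)
  ultimately show ?thesis
    by (metis mult.assoc mult_1)
qed

text \<open>Integrating \<open>powr_young\<close> against \<open>w\<close> gives one linear bound
  for each \<open>m > 0\<close>; the best \<open>m\<close> turns it into the product form. The
  majorant \<open>k\<close> replaces \<open>g powr q\<close>, so that integrability is asked only of
  \<open>w * k\<close>.\<close>

lemma weighted_power_mean:
  fixes w g k :: "'a::euclidean_space \<Rightarrow> real" and q :: real
  assumes q: "q \<ge> 1"
    and w0: "\<And>t. t \<in> S \<Longrightarrow> 0 \<le> w t" and g0: "\<And>t. t \<in> S \<Longrightarrow> 0 \<le> g t"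
    and gk: "\<And>t. t \<in> S \<Longrightarrow> g t powr q \<le> k t"
    and wi: "w integrable_on S" and wgi: "(\<lambda>t. w t * g t) integrable_on S"
    and wki: "(\<lambda>t. w t * k t) integrable_on S"
    and W: "integral S w > 0"
  shows "integral S (\<lambda>t. w t * g t)
      \<le> integral S w powr (1 - 1/q) * integral S (\<lambda>t. w t * k t) powr (1/q)"
proof -
  let ?W = "integral S w" and ?E = "integral S (\<lambda>t. w t * k t)"
  have bound: "integral S (\<lambda>t. w t * g t) \<le> (1 - 1/q) * m * ?W + (1/q) * m powr (1 - q) * ?E"
    if m: "m > 0" for m
  proof -
    have "integral S (\<lambda>t. w t * g t)
        \<le> integral S (\<lambda>t. (1 - 1/q) * m * w t + (1/q) * m powr (1 - q) * (w t * k t))"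
    proof (rule integral_le[OF wgi])
      show "(\<lambda>t. (1 - 1/q) * m * w t + (1/q) * m powr (1 - q) * (w t * k t)) integrable_on S"
        by (intro integrable_add integrable_on_mult_right wi wki)
    next
      fix t assume t: "t \<in> S"
      have "g t \<le> (1 - 1/q) * m + (1/q) * (m powr (1 - q) * g t powr q)"
        by (rule powr_young) (use g0[OF t] m q in auto)
      also have "\<dots> \<le> (1 - 1/q) * m + (1/q) * (m powr (1 - q) * k t)"
        using gk[OF t] q by (intro add_left_mono mult_left_mono) auto
      finally have "w t * g t \<le> w t * ((1 - 1/q) * m + (1/q) * (m powr (1 - q) * k t))"
        by (rule mult_left_mono) (rule w0[OF t])
      then show "w t * g t \<le> (1 - 1/q) * m * w t + (1/q) * m powr (1 - q) * (w t * k t)"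
        by (simp add: algebra_simps)
    qed
    also have "\<dots> = (1 - 1/q) * m * ?W + (1/q) * m powr (1 - q) * ?E"
      by (subst integral_add)
        (auto intro: integrable_on_mult_right wi wki
          simp del: mult.assoc times_divide_eq_left times_divide_eq_right)
    finally show ?thesis .
  qed
  have "k t \<ge> 0" if "t \<in> S" for t
    using gk[OF that] powr_ge_zero[of "g t" q] by linarith
  then have E0: "?E \<ge> 0"
    by (intro Henstock_Kurzweil_Integration.integral_nonneg wki mult_nonneg_nonneg w0) auto
  show ?thesis
  proof (cases "?E = 0")
    case True
    \<comment> \<open>The optimal \<open>m\<close> would be 0 here, which is not admissible; letting
      \<open>m = e / ?W\<close> tend to 0 has the same effect.\<close>
    have "integral S (\<lambda>t. w t * g t) \<le> 0 + e" if e: "e > 0" for e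
    proof -
      have "integral S (\<lambda>t. w t * g t) \<le> (1 - 1/q) * e"
        using bound[of "e / ?W"] True W e by simp
      also have "\<dots> \<le> 1 * e"
        using q e by (intro mult_right_mono) auto
      finally show ?thesis by simp
    qed
    then have "integral S (\<lambda>t. w t * g t) \<le> 0"
      by (rule field_le_epsilon)
    with True show ?thesis by simp
  next
    case False
    with E0 have E: "?E > 0" by simp
    \<comment> \<open>This \<open>m\<close> balances the two terms:
      \<open>m powr (1 - q) * ?E = m * ?W\<close>, so their weighted sum collapses to
      \<open>m * ?W\<close>.\<close>
    define m where "m = (?E / ?W) powr (1/q)"
    have m: "m > 0" using E W by (simp add: m_def)
    have mW: "m * ?W = ?W powr (1 - 1/q) * ?E powr (1/q)"
      using E W by (simp add: m_def powr_divide powr_diff)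
    have "m powr (1 - q) * ?E = m * (m powr (- q) * ?E)"
      using m by (simp add: powr_diff powr_minus field_simps)
    also have "m powr (- q) * ?E = ?W"
      using E W q by (simp add: m_def powr_powr powr_minus field_simps)
    finally have mE: "m powr (1 - q) * ?E = m * ?W" .
    have "(1 - 1/q) * m * ?W + (1/q) * m powr (1 - q) * ?E = m * ?W"
      using mE by (simp add: algebra_simps)
    with bound[OF m] mW show ?thesis by simp
  qed
qed

section \<open>Integration by parts with a power weight\<close>

text \<open>The boundary term at 0 vanishes because \<alpha> is positive. Integrability of the
  possibly singular integrand with exponent \<open>\<alpha> - 1\<close> is a result, not an
  assumption: it is the difference of two integrable functions.\<close>

lemma powr_integral_by_parts:
  fixes \<phi> \<phi>' :: "real \<Rightarrow> real" and \<alpha> :: real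
  assumes der: "\<And>t. t \<in> {0..1} \<Longrightarrow> (\<phi> has_real_derivative \<phi>' t) (at t within {0..1})"
    and K: "\<And>t. t \<in> {0..1} \<Longrightarrow> \<bar>\<phi>' t\<bar> \<le> K"
    and \<alpha>: "\<alpha> > 0"
  shows "(\<lambda>t. t powr \<alpha> * \<phi>' t) absolutely_integrable_on {0..1}"
    and "((\<lambda>t. t powr (\<alpha> - 1) * \<phi> t) has_integral
           (\<phi> 1 - integral {0..1} (\<lambda>t. t powr \<alpha> * \<phi>' t)) / \<alpha>) {0..1}"
proof -
  have "(\<phi>' has_integral (\<phi> 1 - \<phi> 0)) {0..1}"
    by (rule fundamental_theorem_of_calculus)
      (use der in \<open>auto simp: has_real_derivative_iff_has_vector_derivative\<close>)
  then have "\<phi>' integrable_on {0..1}" by blast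
  \<comment> \<open>A derivative is a priori only gauge integrable; the bound \<open>K\<close> makes
    it absolutely integrable.\<close>
  then have ai: "\<phi>' absolutely_integrable_on {0..1}"
    by (rule absolutely_integrable_integrable_bound[rotated]) (use K in auto)
  have cont: "continuous_on {0..1} (\<lambda>t::real. t powr \<alpha>)"
    using \<alpha> by (intro continuous_on_powr' continuous_intros) auto
  have bd: "bounded ((\<lambda>t::real. t powr \<alpha>) ` {0..1})"
    by (intro compact_imp_bounded compact_continuous_image cont) simp
  show prod: "(\<lambda>t. t powr \<alpha> * \<phi>' t) absolutely_integrable_on {0..1}"
    by (intro absolutely_integrable_bounded_measurable_product_real bd ai
        continuous_imp_measurable_on_sets_lebesgue cont) auto
  have c\<phi>: "continuous_on {0..1} \<phi>"
    using der by (intro continuous_on_eq_continuous_within[THEN iffD2]) (meson DERIV_continuous)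
  have "((\<lambda>t. \<alpha> * t powr (\<alpha> - 1) * \<phi> t + t powr \<alpha> * \<phi>' t) has_integral
          (1 powr \<alpha> * \<phi> 1 - 0 powr \<alpha> * \<phi> 0)) {0..1}"
  \<comment> \<open>For \<alpha> below 1 the power is not differentiable at 0, so only continuity is
    used at the endpoints.\<close>
  proof (rule fundamental_theorem_of_calculus_interior)
    show "continuous_on {0..1} (\<lambda>t. t powr \<alpha> * \<phi> t)"
      by (intro continuous_on_mult cont c\<phi>)
    fix t :: real assume t: "t \<in> {0<..<1}"
    have "(\<phi> has_real_derivative \<phi>' t) (at t)"
      using der[of t] t at_within_Icc_at[of 0 t 1] by auto
    then have "((\<lambda>t. t powr \<alpha> * \<phi> t) has_real_derivative
        \<alpha> * t powr (\<alpha> - 1) * \<phi> t + t powr \<alpha> * \<phi>' t) (at t)"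
      using t by (auto intro!: derivative_eq_intros)
    then show "((\<lambda>t. t powr \<alpha> * \<phi> t) has_vector_derivative
        \<alpha> * t powr (\<alpha> - 1) * \<phi> t + t powr \<alpha> * \<phi>' t) (at t)"
      by (simp add: has_real_derivative_iff_has_vector_derivative)
  qed simp
  from has_integral_diff[OF this integrable_integral[OF
        set_lebesgue_integral_eq_integral(1)[OF prod]]]
  have "((\<lambda>t. \<alpha> * (t powr (\<alpha> - 1) * \<phi> t)) has_integral
      (\<phi> 1 - integral {0..1} (\<lambda>t. t powr \<alpha> * \<phi>' t))) {0..1}"
    by (simp add: mult.assoc)
  from has_integral_mult_right[OF this, of "1/\<alpha>"]
  show "((\<lambda>t. t powr (\<alpha> - 1) * \<phi> t) has_integral
      (\<phi> 1 - integral {0..1} (\<lambda>t. t powr \<alpha> * \<phi>' t)) / \<alpha>) {0..1}"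
    using \<alpha> by simp
qed

section \<open>The estimate along a harmonic path from \<open>c\<close> to \<open>x\<close>\<close>

text \<open>A weighted harmonic mean lies between its arguments. Using \<open>closed_segment\<close>
  leaves the order of \<open>c\<close> and \<open>x\<close> open, so that \<open>c\<close> can later
  be either \<open>a\<close> or \<open>b\<close>.\<close>

lemma harmonic_segment:
  fixes c x t :: real
  assumes "c > 0" "x > 0" "t \<in> {0..1}"
  shows "t * c + (1 - t) * x > 0" and "c * x / (t * c + (1 - t) * x) \<in> closed_segment c x"
proof -
  let ?D = "t * c + (1 - t) * x"
  have D: "?D \<in> closed_segment x c"
    using assms by (auto simp: closed_segment_def intro!: exI[of _ t])
  then show D0: "?D > 0"
    using assms by (auto simp: closed_segment_eq_real_ivl split: if_splits)
  have "min c x * ?D \<le> c * x" "c * x \<le> max c x * ?D"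
    using D assms
    by (auto simp: closed_segment_eq_real_ivl min_def max_def mult.commute split: if_splits)
  then have "min c x \<le> c * x / ?D" "c * x / ?D \<le> max c x"
    using D0 by (auto simp: field_simps)
  then show "c * x / ?D \<in> closed_segment c x"
    by (auto simp: closed_segment_eq_real_ivl min_def max_def split: if_splits)
qed

lemma continuous_on_harmonic_weight:
  fixes c x \<alpha> :: real
  assumes "c > 0" "x > 0" "\<alpha> > 0"
  shows "continuous_on {0..1} (\<lambda>t. t powr \<alpha> / (t * c + (1 - t) * x)\<^sup>2)"
proof -
  have "t * c + (1 - t) * x \<noteq> 0" if "t \<in> {0..1}" for t
    using harmonic_segment(1)[OF assms(1,2) that] by simp
  then show ?thesis
    using assms by (intro continuous_intros continuous_on_powr') auto
qed

lemma half_functional_bound: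
  fixes f f' :: "real \<Rightarrow> real" and c x \<alpha> s q :: real
  assumes pos: "c > 0" "x > 0" and cx: "c \<noteq> x" and \<alpha>: "\<alpha> > 0" and s: "s > 0" and q: "q \<ge> 1"
    and der: "\<And>y. y \<in> closed_segment c x \<Longrightarrow>
      (f has_real_derivative f' y) (at y within closed_segment c x)"
    and conv: "harmonically_s_convex_on s K (\<lambda>y. \<bar>f' y\<bar> powr q)" "c \<in> K" "x \<in> K"
  defines "\<phi> \<equiv> \<lambda>t. f (c * x / (t * c + (1 - t) * x))"
    and "w \<equiv> \<lambda>t. t powr \<alpha> / (t * c + (1 - t) * x)\<^sup>2"
  shows "(\<lambda>t. t powr (\<alpha> - 1) * \<phi> t) integrable_on {0..1}"
    and "\<bar>f x - \<alpha> * integral {0..1} (\<lambda>t. t powr (\<alpha> - 1) * \<phi> t)\<bar>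
      \<le> \<bar>x - c\<bar> * (c * x) * (integral {0..1} w powr (1 - 1/q) *
          (integral {0..1} (\<lambda>t. w t * t powr s) * \<bar>f' x\<bar> powr q +
           integral {0..1} (\<lambda>t. w t * (1 - t) powr s) * \<bar>f' c\<bar> powr q) powr (1/q))"
proof -
  define y where "y = (\<lambda>t. c * x / (t * c + (1 - t) * x))"
  define \<phi>' where "\<phi>' = (\<lambda>t. f' (y t) * (- (c * x) * (c - x) / (t * c + (1 - t) * x)\<^sup>2))"
  note D0 = harmonic_segment(1)[OF pos]
  have yseg: "y t \<in> closed_segment c x" if "t \<in> {0..1}" for t
    unfolding y_def by (rule harmonic_segment(2)[OF pos that])
  have yder: "(y has_real_derivative (- (c * x) * (c - x) / (t * c + (1 - t) * x)\<^sup>2))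
      (at t within {0..1})" if "t \<in> {0..1}" for t
    unfolding y_def using D0[OF that]
    by (auto intro!: derivative_eq_intros simp: power2_eq_square)
  have der\<phi>: "(\<phi> has_real_derivative \<phi>' t) (at t within {0..1})" if t: "t \<in> {0..1}" for t
  proof -
    have "(f has_real_derivative f' (y t)) (at (y t) within y ` {0..1})"
      by (rule DERIV_subset[OF der[OF yseg[OF t]]]) (use yseg in auto)
    from DERIV_image_chain[OF this yder[OF t]]
    show ?thesis
      by (simp add: \<phi>_def \<phi>'_def y_def o_def)
  qed
  define h where "h = (\<lambda>z. \<bar>f' z\<bar> powr q)"
  define k where "k = (\<lambda>t. t powr s * h x + (1 - t) powr s * h c)"
  have gk: "\<bar>f' (y t)\<bar> powr q \<le> k t" if "t \<in> {0..1}" for t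
    using conv that by (auto simp: harmonically_s_convex_on_def y_def k_def h_def)
  \<comment> \<open>Both \<open>t powr s\<close> and \<open>(1 - t) powr s\<close> are at most 1, so
    \<open>k\<close> is at most \<open>h x + h c\<close>; its \<open>q\<close>-th root bounds
    \<open>f'\<close> along the path.\<close>
  define M where "M = (h x + h c) powr (1/q)"
  have f'M: "\<bar>f' (y t)\<bar> \<le> M" if t: "t \<in> {0..1}" for t
  proof -
    have "k t \<le> 1 * h x + 1 * h c"
      unfolding k_def using t s
      by (intro add_mono mult_right_mono) (auto simp: h_def powr_le1)
    with gk[OF t] have "(\<bar>f' (y t)\<bar> powr q) powr (1/q) \<le> M"
      unfolding M_def using q by (intro powr_mono2) auto
    then show ?thesis using q by (simp add: powr_powr)
  qed
  have c0: "continuous_on {0..1} (\<lambda>t. - (c * x) * (c - x) / (t * c + (1 - t) * x)\<^sup>2)"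
    using D0 by (intro continuous_intros) fastforce
  then have "bounded ((\<lambda>t. - (c * x) * (c - x) / (t * c + (1 - t) * x)\<^sup>2) ` {0..1})"
    by (intro compact_imp_bounded compact_continuous_image) auto
  then obtain N where N: "\<And>t. t \<in> {0..1} \<Longrightarrow>
      \<bar>- (c * x) * (c - x) / (t * c + (1 - t) * x)\<^sup>2\<bar> \<le> N"
    unfolding bounded_iff by fastforce
  have \<phi>'M: "\<bar>\<phi>' t\<bar> \<le> M * N" if t: "t \<in> {0..1}" for t
    unfolding \<phi>'_def abs_mult[of "f' (y t)"]
    by (intro mult_mono f'M[OF t] N[OF t]) (auto simp: M_def)
  note parts = powr_integral_by_parts[OF der\<phi> \<phi>'M \<alpha>]
  from parts(2) show "(\<lambda>t. t powr (\<alpha> - 1) * \<phi> t) integrable_on {0..1}" by blast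
  have \<phi>1: "\<phi> 1 = f x" using pos by (simp add: \<phi>_def)
  define L where "L = \<bar>x - c\<bar> * (c * x)"
  have L: "L > 0" using pos cx by (simp add: L_def)
  \<comment> \<open>The chain rule factor supplies the squared denominator of \<open>w\<close>,
    leaving the constant \<open>L\<close>.\<close>
  have eq: "\<bar>t powr \<alpha> * \<phi>' t\<bar> = L * (w t * \<bar>f' (y t)\<bar>)" for t
    using pos by (simp add: L_def w_def \<phi>'_def abs_mult abs_minus_commute)
  have absi: "(\<lambda>t. L * (w t * \<bar>f' (y t)\<bar>)) integrable_on {0..1}"
    using absolutely_integrable_norm[OF parts(1)]
    by (simp add: o_def eq set_lebesgue_integral_eq_integral(1))
  then have wgi: "(\<lambda>t. w t * \<bar>f' (y t)\<bar>) integrable_on {0..1}"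
    using L by (simp add: integrable_on_cmult_left_iff)
  have cw: "continuous_on {0..1} w"
    unfolding w_def by (rule continuous_on_harmonic_weight[OF pos \<alpha>])
  have cs: "continuous_on {0..1} (\<lambda>t::real. t powr s)"
    "continuous_on {0..1} (\<lambda>t::real. (1 - t) powr s)"
    by (intro continuous_on_powr' continuous_intros; use s in auto)+
  have wsi: "(\<lambda>t. w t * t powr s) integrable_on {0..1}"
    "(\<lambda>t. w t * (1 - t) powr s) integrable_on {0..1}"
    by (auto intro!: integrable_continuous_real continuous_on_mult cw cs)
  have wi: "w integrable_on {0..1}" by (rule integrable_continuous_real[OF cw])
  have w0: "w t \<ge> 0" for t by (simp add: w_def)
  have W: "integral {0..1} w > 0"
  proof -
    \<comment> \<open>A continuous nonnegative function with zero integral vanishes identically, but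
      \<open>w 1\<close> is the reciprocal of the square of \<open>c\<close>.\<close>
    have "integral {0..1} w \<noteq> 0"
      using integral_eq_0_iff[OF cw] w0 pos \<alpha>
      by (auto simp: w_def intro!: bexI[of _ 1])
    moreover have "integral {0..1} w \<ge> 0"
      by (rule Henstock_Kurzweil_Integration.integral_nonneg[OF wi]) (rule w0)
    ultimately show ?thesis by simp
  qed
  have wk: "((\<lambda>t. w t * k t) has_integral
      integral {0..1} (\<lambda>t. w t * t powr s) * h x +
      integral {0..1} (\<lambda>t. w t * (1 - t) powr s) * h c) {0..1}"
    using has_integral_add[OF has_integral_mult_left[OF integrable_integral[OF wsi(1)], of "h x"]
      has_integral_mult_left[OF integrable_integral[OF wsi(2)], of "h c"]]
    by (simp add: k_def algebra_simps)
  have "\<bar>f x - \<alpha> * integral {0..1} (\<lambda>t. t powr (\<alpha> - 1) * \<phi> t)\<bar>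
      = \<bar>integral {0..1} (\<lambda>t. t powr \<alpha> * \<phi>' t)\<bar>"
    using parts(2) \<alpha> by (simp add: integral_unique \<phi>1)
  also have "\<dots> \<le> integral {0..1} (\<lambda>t. L * (w t * \<bar>f' (y t)\<bar>))"
    using integral_norm_bound_integral[OF set_lebesgue_integral_eq_integral(1)[OF parts(1)] absi]
    by (simp add: eq)
  also have "\<dots> = L * integral {0..1} (\<lambda>t. w t * \<bar>f' (y t)\<bar>)" by simp
  also have "\<dots> \<le> L * (integral {0..1} w powr (1 - 1/q) *
      integral {0..1} (\<lambda>t. w t * k t) powr (1/q))"
    by (intro mult_left_mono weighted_power_mean q w0 gk wi wgi W has_integral_integrable[OF wk])
      (use L in auto)
  finally show "\<bar>f x - \<alpha> * integral {0..1} (\<lambda>t. t powr (\<alpha> - 1) * \<phi> t)\<bar>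
      \<le> \<bar>x - c\<bar> * (c * x) * (integral {0..1} w powr (1 - 1/q) *
          (integral {0..1} (\<lambda>t. w t * t powr s) * \<bar>f' x\<bar> powr q +
           integral {0..1} (\<lambda>t. w t * (1 - t) powr s) * \<bar>f' c\<bar> powr q) powr (1/q))"
    unfolding integral_unique[OF wk] L_def h_def .
qed

section \<open>Euler integrals for the hypergeometric coefficients\<close>

lemma has_integral_one_minus:
  fixes f :: "real \<Rightarrow> real"
  assumes "(f has_integral i) {0..1}"
  shows "((\<lambda>t. f (1 - t)) has_integral i) {0..1}"
  using has_integral_affinity[of f i 0 1 "-1" 1] assms
  by (simp add: image_affinity_cbox[of "-1::real", simplified])

text \<open>Reflection is an involution, so \<open>has_integral\<close> transfers in both
  directions. No integrability is assumed: otherwise both sides take the same default value.\<close>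

lemma integral_one_minus:
  fixes f :: "real \<Rightarrow> real"
  shows "integral {0..1} (\<lambda>t. f (1 - t)) = integral {0..1} f"
proof -
  have "((\<lambda>t. f (1 - t)) has_integral i) {0..1} \<longleftrightarrow> (f has_integral i) {0..1}" for i
    using has_integral_one_minus[of f i] has_integral_one_minus[of "\<lambda>t. f (1 - t)" i] by auto
  then show ?thesis by (simp add: integral_def integrable_on_def)
qed

text \<open>The base \<open>1 - (1 - c / x) * t\<close> equals
  \<open>(t * c + (1 - t) * x) / x\<close>, so its power \<open>- 2\<close> cancels the prefactor in
  \<open>x\<close>, while the Beta factor cancels the normalization of
  \<open>hyp2F1\<close>.\<close>

lemma hyp2F1_two_integral:
  fixes c x B C E :: real
  assumes pos: "c > 0" "x > 0" and BE: "B > 0" "E > 0" and C: "C = B + E"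
  shows "Beta B E / x\<^sup>2 * hyp2F1 2 B C (1 - c / x) =
    integral {0..1} (\<lambda>t. t powr (B - 1) * (1 - t) powr (E - 1) / (t * c + (1 - t) * x)\<^sup>2)"
proof -
  have "Beta B E > 0"
    using BE by (simp add: Beta_def Gamma_real_pos)
  then have "Beta B E / x\<^sup>2 * hyp2F1 2 B C (1 - c / x) =
    integral {0..1} (\<lambda>t. 1 / x\<^sup>2 * (t powr (B - 1) * (1 - t) powr (E - 1) *
      (1 - (1 - c / x) * t) powr (- 2)))"
    by (simp add: hyp2F1_def C)
  also have "\<dots> = integral {0..1} (\<lambda>t. t powr (B - 1) * (1 - t) powr (E - 1) /
      (t * c + (1 - t) * x)\<^sup>2)"
  proof (rule integral_cong)
    fix t :: real assume t: "t \<in> {0..1}"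
    have D: "t * c + (1 - t) * x > 0" by (rule harmonic_segment(1)[OF pos t])
    have e: "1 - (1 - c / x) * t = (t * c + (1 - t) * x) / x"
      using pos by (simp add: field_simps)
    show "1 / x\<^sup>2 * (t powr (B - 1) * (1 - t) powr (E - 1) * (1 - (1 - c / x) * t) powr (- 2))
      = t powr (B - 1) * (1 - t) powr (E - 1) / (t * c + (1 - t) * x)\<^sup>2"
      unfolding e using D pos by (simp add: powr_minus powr_divide field_simps)
  qed
  finally show ?thesis .
qed

text \<open>Exchanging \<open>c\<close> and \<open>x\<close> and reflecting \<open>t\<close> swaps
  the two exponents but restores the denominator. This serves the endpoint \<open>b\<close>, where
  the argument is \<open>1 - x / b\<close>.\<close>

lemma hyp2F1_two_integral_reflected:
  fixes c x B C E :: real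
  assumes "c > 0" "x > 0" "B > 0" "E > 0" "C = B + E"
  shows "Beta B E / c\<^sup>2 * hyp2F1 2 B C (1 - x / c) =
    integral {0..1} (\<lambda>t. t powr (E - 1) * (1 - t) powr (B - 1) / (t * c + (1 - t) * x)\<^sup>2)"
  unfolding hyp2F1_two_integral[OF assms(2,1,3,4,5)]
  by (subst integral_one_minus[symmetric]) (simp add: add.commute mult.commute)

lemma Beta_one_right:
  fixes u :: real
  assumes "u > 0"
  shows "Beta u 1 = 1 / u"
proof -
  have "Gamma u \<noteq> 0" using Gamma_real_pos[OF assms] by linarith
  moreover have "u \<notin> \<int>\<^sub>\<le>\<^sub>0" using assms by (auto simp: nonpos_Ints_def)
  ultimately show ?thesis by (simp add: Beta_def Gamma_plus1)
qed

context
  fixes c x \<alpha> :: real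
  assumes pos: "c > 0" "x > 0" "\<alpha> > 0"
begin

text \<open>Several integrands carry a factor with exponent 0, which in Isabelle is 0 instead of 1
  where its base vanishes (\<open>0 powr 0 = 0\<close>); they agree with the expected ones off a null set.\<close>

lemma lambda1_eq:
  assumes "s > 0"
  shows "lambda1 c x s 1 \<alpha> =
    integral {0..1} (\<lambda>t. t powr \<alpha> / (t * c + (1 - t) * x)\<^sup>2 * t powr s)"
proof -
  have "lambda1 c x s 1 \<alpha> =
      integral {0..1} (\<lambda>t. t powr (\<alpha> + s) * (1 - t) powr 0 / (t * c + (1 - t) * x)\<^sup>2)"
    using hyp2F1_two_integral[of c x "\<alpha> + s + 1" 1 "\<alpha> + s + 2"] pos assms
    by (simp add: lambda1_def)
  also have "\<dots> = integral {0..1} (\<lambda>t. t powr \<alpha> / (t * c + (1 - t) * x)\<^sup>2 * t powr s)"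
    by (rule integral_spike[of "{0,1}"]) (auto simp: powr_add)
  finally show ?thesis .
qed

lemma lambda2_eq:
  assumes "s > 0"
  shows "lambda2 c x s 1 \<alpha> =
    integral {0..1} (\<lambda>t. t powr \<alpha> / (t * c + (1 - t) * x)\<^sup>2 * (1 - t) powr s)"
  using hyp2F1_two_integral[of c x "\<alpha> + 1" "s + 1" "\<alpha> + s + 2"] pos assms
  by (simp add: lambda2_def)

text \<open>The integral is the one found for \<open>lambda1\<close>, so a single estimate in
  \<open>c\<close> covers both endpoints.\<close>

lemma lambda3_eq:
  assumes "s > 0"
  shows "lambda3 c x s 1 \<alpha> =
    integral {0..1} (\<lambda>t. t powr \<alpha> / (t * c + (1 - t) * x)\<^sup>2 * t powr s)"
proof -
  have "lambda3 c x s 1 \<alpha> =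
      integral {0..1} (\<lambda>t. t powr (\<alpha> + s) * (1 - t) powr 0 / (t * c + (1 - t) * x)\<^sup>2)"
    using hyp2F1_two_integral_reflected[of c x 1 "\<alpha> + s + 1" "\<alpha> + s + 2"] pos assms
    by (simp add: lambda3_def)
  also have "\<dots> = integral {0..1} (\<lambda>t. t powr \<alpha> / (t * c + (1 - t) * x)\<^sup>2 * t powr s)"
    by (rule integral_spike[of "{0,1}"]) (auto simp: powr_add)
  finally show ?thesis .
qed

lemma lambda4_eq:
  assumes "s > 0"
  shows "lambda4 c x s 1 \<alpha> =
    integral {0..1} (\<lambda>t. t powr \<alpha> / (t * c + (1 - t) * x)\<^sup>2 * (1 - t) powr s)"
  using hyp2F1_two_integral_reflected[of c x "s + 1" "\<alpha> + 1" "\<alpha> + s + 2"] pos assms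
  by (simp add: lambda4_def)

text \<open>\<open>lambda5\<close> carries no Beta factor; \<open>1 / (\<alpha> + 1)\<close> is the
  missing \<open>Beta (\<alpha> + 1) 1\<close>.\<close>

lemma lambda5_eq:
  "1 / (\<alpha> + 1) * lambda5 c x \<alpha> = integral {0..1} (\<lambda>t. t powr \<alpha> / (t * c + (1 - t) * x)\<^sup>2)"
proof -
  have "1 / (\<alpha> + 1) * lambda5 c x \<alpha> =
      integral {0..1} (\<lambda>t. t powr \<alpha> * (1 - t) powr 0 / (t * c + (1 - t) * x)\<^sup>2)"
    using hyp2F1_two_integral[of c x "\<alpha> + 1" 1 "\<alpha> + 2"] pos
    by (simp add: lambda5_def Beta_one_right)
  also have "\<dots> = integral {0..1} (\<lambda>t. t powr \<alpha> / (t * c + (1 - t) * x)\<^sup>2)"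
    by (rule integral_spike[of "{0,1}"]) auto
  finally show ?thesis .
qed

lemma lambda6_eq:
  "1 / (\<alpha> + 1) * lambda6 c x \<alpha> = integral {0..1} (\<lambda>t. t powr \<alpha> / (t * c + (1 - t) * x)\<^sup>2)"
proof -
  have "1 / (\<alpha> + 1) * lambda6 c x \<alpha> =
      integral {0..1} (\<lambda>t. t powr \<alpha> * (1 - t) powr 0 / (t * c + (1 - t) * x)\<^sup>2)"
    using hyp2F1_two_integral_reflected[of c x 1 "\<alpha> + 1" "\<alpha> + 2"] pos
    by (simp add: lambda6_def Beta_one_right Beta_commute[of 1])
  also have "\<dots> = integral {0..1} (\<lambda>t. t powr \<alpha> / (t * c + (1 - t) * x)\<^sup>2)"
    by (rule integral_spike[of "{0,1}"]) auto
  finally show ?thesis .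
qed

end

section \<open>Substitution in the fractional integrals\<close>

text \<open>The affine map sending \<open>1 / c\<close> to 0 and \<open>1 / x\<close> to 1 turns the
  harmonic path into \<open>1 / t\<close>.\<close>

lemma has_integral_harmonic_substitution:
  fixes f :: "real \<Rightarrow> real" and c x \<alpha> i :: real
  assumes pos: "c > 0" "x > 0" and cx: "c \<noteq> x"
    and int: "((\<lambda>t. t powr (\<alpha> - 1) * f (c * x / (t * c + (1 - t) * x))) has_integral i) {0..1}"
  shows "((\<lambda>t. \<bar>1 / c - t\<bar> powr (\<alpha> - 1) * f (1 / t)) has_integral
      (\<bar>x - c\<bar> / (c * x)) powr \<alpha> * i) (closed_segment (1 / c) (1 / x))"
proof -
  \<comment> \<open>Slope of that map, the reciprocal of \<open>1 / x - 1 / c\<close>; it is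
    negative for \<open>c < x\<close>.\<close>
  define m where "m = c * x / (c - x)"
  define d where "d = \<bar>x - c\<bar> / (c * x)"
  have m: "m \<noteq> 0" using pos cx by (simp add: m_def)
  have d: "d > 0" using pos cx by (simp add: d_def)
  have md: "1 / \<bar>m\<bar> = d" using pos by (simp add: m_def d_def abs_mult abs_minus_commute)
  have "(\<lambda>t. (1 / m) * t + 1 / c) ` {0..1} = closed_segment (1 / c) (1 / x)"
  proof -
    have "(1 / m) * t + 1 / c = (1 - t) * (1 / c) + t * (1 / x)" for t
      using pos cx by (simp add: m_def field_simps)
    then show ?thesis by (simp add: closed_segment_image_interval)
  qed
  moreover have "- ((1 / m) * (- (m / c))) = 1 / c" using m by simp
  ultimately have "((\<lambda>t. (m * t - m / c) powr (\<alpha> - 1) *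
      f (c * x / ((m * t - m / c) * c + (1 - (m * t - m / c)) * x))) has_integral d * i)
      (closed_segment (1 / c) (1 / x))"
    using has_integral_affinity[of _ i 0 1 m "- (m / c)", OF int[folded box_real(2)] m] md m
    by simp
  \<comment> \<open>The Jacobian gives one factor \<open>d\<close>; the remaining
    \<open>d powr (\<alpha> - 1)\<close> rescales the kernel to
    \<open>\<bar>1 / c - t\<bar>\<close>.\<close>
  from has_integral_mult_right[OF this, of "d powr (\<alpha> - 1)"]
  have "((\<lambda>t. d powr (\<alpha> - 1) * ((m * t - m / c) powr (\<alpha> - 1) *
      f (c * x / ((m * t - m / c) * c + (1 - (m * t - m / c)) * x)))) has_integral d powr \<alpha> * i)
      (closed_segment (1 / c) (1 / x))"
    using d by (simp add: powr_diff)
  moreover have "d powr (\<alpha> - 1) * ((m * t - m / c) powr (\<alpha> - 1) *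
      f (c * x / ((m * t - m / c) * c + (1 - (m * t - m / c)) * x)))
      = \<bar>1 / c - t\<bar> powr (\<alpha> - 1) * f (1 / t)"
    if t: "t \<in> closed_segment (1 / c) (1 / x)" for t
  proof -
    have "(m * t - m / c) * c + (1 - (m * t - m / c)) * x = x + m * (t - 1 / c) * (c - x)"
      using pos by (simp add: field_simps)
    also have "\<dots> = c * x * t"
      using pos cx by (simp add: m_def field_simps)
    finally have "c * x / ((m * t - m / c) * c + (1 - (m * t - m / c)) * x) = 1 / t"
      using pos by simp
    moreover have nn: "m * t - m / c \<ge> 0"
    proof -
      have "m * (t - 1 / c) \<ge> 0"
      proof (cases "c < x")
        case True
        then have "m < 0" "t - 1 / c \<le> 0"
          using pos t by (auto simp: m_def closed_segment_eq_real_ivl divide_simps split: if_splits)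
        then show ?thesis by (simp add: mult_nonpos_nonpos)
      next
        case False
        then have "m > 0" "t - 1 / c \<ge> 0"
          using pos cx t
          by (auto simp: m_def closed_segment_eq_real_ivl divide_simps split: if_splits)
        then show ?thesis by simp
      qed
      then show ?thesis by (simp add: algebra_simps)
    qed
    moreover have "d * (m * t - m / c) = \<bar>1 / c - t\<bar>"
    proof -
      have "d * (m * t - m / c) = d * \<bar>m * (t - 1 / c)\<bar>"
        using nn by (simp add: right_diff_distrib)
      also have "\<dots> = \<bar>1 / c - t\<bar>"
        unfolding abs_mult md[symmetric] using m by (simp add: abs_minus_commute)
      finally show ?thesis .
    qed
    ultimately show ?thesis
      by (metis mult.assoc powr_mult)
  qed
  ultimately show ?thesis
    unfolding d_def[symmetric] by (simp cong: has_integral_cong)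
qed

text \<open>This is \<open>half_functional_bound\<close> scaled by the factor from the substitution,
  which combines with \<open>\<bar>x - c\<bar> * (c * x)\<close> into the stated quotient of
  powers.\<close>

lemma half_term_bound:
  fixes f f' :: "real \<Rightarrow> real" and c x \<alpha> s q :: real
  assumes pos: "c > 0" "x > 0" and \<alpha>: "\<alpha> > 0" and s: "s > 0" and q: "q \<ge> 1"
    and der: "\<And>y. y \<in> closed_segment c x \<Longrightarrow>
      (f has_real_derivative f' y) (at y within closed_segment c x)"
    and conv: "harmonically_s_convex_on s K (\<lambda>y. \<bar>f' y\<bar> powr q)" "c \<in> K" "x \<in> K"
  defines "w \<equiv> \<lambda>t. t powr \<alpha> / (t * c + (1 - t) * x)\<^sup>2"
  shows "\<bar>(\<bar>x - c\<bar> / (c * x)) powr \<alpha> * f x -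
        \<alpha> * integral (closed_segment (1 / c) (1 / x)) (\<lambda>t. \<bar>1 / c - t\<bar> powr (\<alpha> - 1) * f (1 / t))\<bar>
      \<le> integral {0..1} w powr (1 - 1/q) * (\<bar>x - c\<bar> powr (\<alpha> + 1) / (c * x) powr (\<alpha> - 1)) *
          (integral {0..1} (\<lambda>t. w t * t powr s) * \<bar>f' x\<bar> powr q +
           integral {0..1} (\<lambda>t. w t * (1 - t) powr s) * \<bar>f' c\<bar> powr q) powr (1/q)"
proof (cases "c = x")
  \<comment> \<open>When \<open>x\<close> is an endpoint, both sides are 0, since
    \<open>0 powr r\<close> is 0 and the segment is a point.\<close>
  case True
  then show ?thesis by simp
next
  case False
  let ?i = "integral {0..1} (\<lambda>t. t powr (\<alpha> - 1) * f (c * x / (t * c + (1 - t) * x)))"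
  let ?d = "(\<bar>x - c\<bar> / (c * x)) powr \<alpha>"
  note half = half_functional_bound[OF pos False \<alpha> s q der conv]
  have i: "integral (closed_segment (1 / c) (1 / x)) (\<lambda>t. \<bar>1 / c - t\<bar> powr (\<alpha> - 1) * f (1 / t))
      = ?d * ?i"
    by (intro integral_unique has_integral_harmonic_substitution pos False
        integrable_integral half(1))
  have "\<bar>?d * f x - \<alpha> * (?d * ?i)\<bar> = ?d * \<bar>f x - \<alpha> * ?i\<bar>"
    by (simp add: abs_mult right_diff_distrib[symmetric] mult.left_commute[of \<alpha>])
  moreover have "?d * (\<bar>x - c\<bar> * (c * x)) = \<bar>x - c\<bar> powr (\<alpha> + 1) / (c * x) powr (\<alpha> - 1)"
    using pos False by (simp add: powr_divide powr_add powr_diff)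
  ultimately show ?thesis
    using mult_left_mono[OF half(2), of ?d]
    unfolding i w_def by (simp add: mult.assoc[symmetric] mult.commute mult.left_commute)
qed

section \<open>Combination of the two endpoint contributions\<close>

text \<open>Taking the derivative within \<open>I\<close> makes \<open>f'\<close> one-sided at an
  endpoint of \<open>I\<close> and two-sided in the interior.\<close>

theorem theorem10:
  fixes f f' :: "real \<Rightarrow> real" and I :: "real set" and a b x \<alpha> s q :: real
  assumes "is_interval I" and "I \<subseteq> {0<..}"
    and "f differentiable_on interior I"
    and "a \<in> I" and "b \<in> I" and "a < b"
    and "\<And>y. y \<in> {a..b} \<Longrightarrow> (f has_real_derivative f' y) (at y within I)"
    and "f' absolutely_integrable_on {a..b}"
    and "\<alpha> > 0" and "0 < s" and "s \<le> 1" and "q \<ge> 1"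
    and "harmonically_s_convex_on s {a..b} (\<lambda>y. \<bar>f' y\<bar> powr q)"
    and "x \<in> {a..b}"
  shows "\<bar>S_func f (\<lambda>u. 1 / u) \<alpha> x a b\<bar> \<le>
    (1 / (\<alpha> + 1)) powr (1 - 1 / q) *
    ( lambda5 a x \<alpha> powr (1 - 1 / q) * ((x - a) powr (\<alpha> + 1) / (a * x) powr (\<alpha> - 1)) *
        (lambda1 a x s 1 \<alpha> * \<bar>f' x\<bar> powr q + lambda2 a x s 1 \<alpha> * \<bar>f' a\<bar> powr q) powr (1 / q)
    + lambda6 b x \<alpha> powr (1 - 1 / q) * ((b - x) powr (\<alpha> + 1) / (b * x) powr (\<alpha> - 1)) *
        (lambda3 b x s 1 \<alpha> * \<bar>f' x\<bar> powr q + lambda4 b x s 1 \<alpha> * \<bar>f' b\<bar> powr q) powr (1 / q) )"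
proof -
  have pos: "a > 0" "b > 0" "x > 0" and ax: "a \<le> x" and xb: "x \<le> b"
    using assms(2,4,5,14) by auto
  have sub: "{a..b} \<subseteq> I"
    using assms(1,4,5) mem_is_interval_1_I[of I a b] by auto
  have der: "(f has_real_derivative f' y) (at y within closed_segment c x)"
    if "c \<in> {a..b}" "y \<in> closed_segment c x" for c y
  proof -
    have seg: "closed_segment c x \<subseteq> {a..b}"
      using that(1) assms(14) by (auto simp: closed_segment_eq_real_ivl split: if_splits)
    show ?thesis
      by (rule DERIV_subset[OF assms(7)]) (use seg sub that(2) in auto)
  qed
  \<comment> \<open>Here \<open>l\<close> stands for \<open>lambda5\<close> when
    \<open>c = a\<close> and for \<open>lambda6\<close> when \<open>c = b\<close>.\<close>
  have half: "\<bar>(\<bar>x - c\<bar> / (c * x)) powr \<alpha> * f x -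
        \<alpha> * integral (closed_segment (1 / c) (1 / x)) (\<lambda>t. \<bar>1 / c - t\<bar> powr (\<alpha> - 1) * f (1 / t))\<bar>
      \<le> (1 / (\<alpha> + 1) * l) powr (1 - 1/q) * (\<bar>x - c\<bar> powr (\<alpha> + 1) / (c * x) powr (\<alpha> - 1)) *
          (integral {0..1} (\<lambda>t. t powr \<alpha> / (t * c + (1 - t) * x)\<^sup>2 * t powr s) * \<bar>f' x\<bar> powr q +
           integral {0..1} (\<lambda>t. t powr \<alpha> / (t * c + (1 - t) * x)\<^sup>2 * (1 - t) powr s) *
             \<bar>f' c\<bar> powr q) powr (1/q)" (is "?L \<le> ?R c l")
    if "c \<in> {a..b}"
      and "1 / (\<alpha> + 1) * l = integral {0..1} (\<lambda>t. t powr \<alpha> / (t * c + (1 - t) * x)\<^sup>2)" for c l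
    unfolding that(2)
    by (rule half_term_bound[OF _ pos(3) assms(9,10,12) der[OF that(1)] assms(13) that(1) assms(14)])
      (use that(1) pos in auto)
  let ?ia = "integral {1 / x..1 / a} (\<lambda>t. (1 / a - t) powr (\<alpha> - 1) * f (1 / t))"
  let ?ib = "integral {1 / b..1 / x} (\<lambda>t. (t - 1 / b) powr (\<alpha> - 1) * f (1 / t))"
  \<comment> \<open>Reciprocals reverse the order: \<open>1 / a\<close> is the right end, matching
    \<open>RL_right\<close>, and \<open>1 / b\<close> is the left end, matching
    \<open>RL_left\<close>.\<close>
  have ia: "integral (closed_segment (1 / a) (1 / x)) (\<lambda>t. \<bar>1 / a - t\<bar> powr (\<alpha> - 1) * f (1 / t)) = ?ia"
  proof -
    have "closed_segment (1 / a) (1 / x) = {1 / x..1 / a}"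
      unfolding closed_segment_commute[of "1 / a"]
      by (rule closed_segment_eq_real_ivl1) (use pos ax in \<open>auto intro: frac_le\<close>)
    then show ?thesis by (auto intro: integral_cong)
  qed
  have ib: "integral (closed_segment (1 / b) (1 / x)) (\<lambda>t. \<bar>1 / b - t\<bar> powr (\<alpha> - 1) * f (1 / t)) = ?ib"
  proof -
    have "closed_segment (1 / b) (1 / x) = {1 / b..1 / x}"
      by (rule closed_segment_eq_real_ivl1) (use pos xb in \<open>auto intro: frac_le\<close>)
    then show ?thesis by (auto intro: integral_cong)
  qed
  have "Gamma (\<alpha> + 1) * (1 / Gamma \<alpha> * ?ib + 1 / Gamma \<alpha> * ?ia) = \<alpha> * ?ib + \<alpha> * ?ia"
  proof -
    have "\<alpha> \<notin> \<int>\<^sub>\<le>\<^sub>0" using assms(9) by (auto simp: nonpos_Ints_def)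
    moreover have "Gamma \<alpha> \<noteq> 0" using Gamma_real_pos[OF assms(9)] by linarith
    ultimately show ?thesis by (simp add: Gamma_plus1 distrib_left)
  qed
  then have S: "S_func f (\<lambda>u. 1 / u) \<alpha> x a b =
      (((x - a) / (a * x)) powr \<alpha> * f x - \<alpha> * ?ia) + (((b - x) / (b * x)) powr \<alpha> * f x - \<alpha> * ?ib)"
    by (simp add: S_func_def RL_left_def RL_right_def o_def algebra_simps)
  have "\<bar>S_func f (\<lambda>u. 1 / u) \<alpha> x a b\<bar> \<le> ?R a (lambda5 a x \<alpha>) + ?R b (lambda6 b x \<alpha>)"
    using half[of a, OF _ lambda5_eq[OF pos(1,3) assms(9)]]
      half[of b, OF _ lambda6_eq[OF pos(2,3) assms(9)]] assms(6) ax xb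
    unfolding S ia ib
    by (intro order_trans[OF abs_triangle_ineq] add_mono) (auto simp: abs_minus_commute)
  also have "\<dots> = (1 / (\<alpha> + 1)) powr (1 - 1 / q) *
    ( lambda5 a x \<alpha> powr (1 - 1 / q) * ((x - a) powr (\<alpha> + 1) / (a * x) powr (\<alpha> - 1)) *
        (lambda1 a x s 1 \<alpha> * \<bar>f' x\<bar> powr q + lambda2 a x s 1 \<alpha> * \<bar>f' a\<bar> powr q) powr (1 / q)
    + lambda6 b x \<alpha> powr (1 - 1 / q) * ((b - x) powr (\<alpha> + 1) / (b * x) powr (\<alpha> - 1)) *
        (lambda3 b x s 1 \<alpha> * \<bar>f' x\<bar> powr q + lambda4 b x s 1 \<alpha> * \<bar>f' b\<bar> powr q) powr (1 / q) )"
  proof -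
    have ends: "\<bar>x - a\<bar> = x - a" "\<bar>x - b\<bar> = b - x" using ax xb by auto
    show ?thesis
      unfolding powr_mult[of "1 / (\<alpha> + 1)"] ends
        lambda1_eq[OF pos(1,3) assms(9,10)] lambda2_eq[OF pos(1,3) assms(9,10)]
        lambda3_eq[OF pos(2,3) assms(9,10)] lambda4_eq[OF pos(2,3) assms(9,10)]
      by (simp only: distrib_left mult.assoc)
  qed
  finally show ?thesis .
qed

end
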